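(* Let the polynomials $\psi_\nu$ be defined by the recurrence in the context; each $\psi_\nu$ has no constant term, and $\psi_1 = x_1$. Let $n \geq 2$ and let $p > n$ be an odd prime. Let $w_1,\ldots,w_n$ be rational numbers with denominators prime to $p$ such that $w_1 \equiv Q_p(1) \pmod{p}$ and, for $\ell = 2,\ldots,n$, \[ w_\ell \equiv Q_p(1) + p\,w_{\ell-1} + \sum_{\nu=1}^{\ell-1} p^\nu\Bigl(\widehat\sigma_{\nu+1}(Q_p) + \binom{p-1}{\nu+1}(-1)^\nu\, w_{\ell-\nu}^{\nu+1}\Bigr) \pmod{p^\ell}. \] Then for every $\ell = 1,\ldots,n$, \[ w_\ell \equiv \sum_{\nu=1}^{\ell}\frac{p^{\nu-1}}{\nu!}\,\psi_\nu\bigl(Q_p(1),\ldots,Q_p(\nu)\bigr) \pmod{p^\ell}. \]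
   Context: $q_p(a) = (a^{p-1}-1)/p$ is the Fermat quotient and $Q_p(m) = \sum_{a=1}^{p-1} q_p(a)^m$. Partial Bell polynomials: $B_{N,k}(y_1,\ldots,y_{N-k+1}) = \sum \frac{N!}{j_1!\cdots j_{N-k+1}!}\prod_{i}(y_i/i!)^{j_i}$ over nonnegative $j_i$ with $\sum_i i j_i = N$, $\sum_i j_i = k$; $B_N = \sum_{k=1}^N B_{N,k}$. Let $\sigma^\star_k = (-1)^k B_k(-x_1,-1!\,x_2,\ldots,-(k-1)!\,x_k)$ and $\widehat\sigma_k = \sigma^\star_k/k!$; $\widehat\sigma_k(Q_p)$ means $\widehat\sigma_k$ evaluated at $x_i = Q_p(i)$. Stirling numbers of the first kind $S_1(N,k)$ are defined by $x(x-1)\cdots(x-N+1) = \sum_k S_1(N,k)x^k$, and $(N)_k = N!/(N-k)!$. Define $\psi_0 = 0$ and for $N \geq 1$ \[ \psi_N = N\,\psi_{N-1} + \sigma^\star_N + \Psi_N,\qquad \Psi_N = \sum_{\nu=2}^{N}\sum_{k=0}^{\min(\nu,N-\nu)} (-1)^{\nu+1} S_1(\nu+1,k+1)\,(N)_k\, B_{N-k,\nu}(\psi_1,\ldots,\psi_{N-k-\nu+1}). \] *)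

theory Defs
  imports
    Complex_Main
    "HOL-Library.Poly_Mapping"
    "HOL-Library.FuncSet"
    "HOL-Computational_Algebra.Polynomial"
    "HOL-Computational_Algebra.Primes"
begin

text \<open>Polynomials over the rationals in the variables \<open>x\<^sub>0, x\<^sub>1, x\<^sub>2, \<dots>\<close> are finitely supported
  maps from monomials (finitely supported exponent vectors) to coefficients; the ring operations
  are the convolution operations of \<^theory>\<open>HOL-Library.Poly_Mapping\<close>. The variable
  \<open>x\<^sub>0\<close> is never used.\<close>

type_synonym mpol = "(nat \<Rightarrow>\<^sub>0 nat) \<Rightarrow>\<^sub>0 rat"

definition mconst :: "rat \<Rightarrow> mpol" where
  "mconst c = Poly_Mapping.single 0 c"

definition mvar :: "nat \<Rightarrow> mpol" where
  "mvar i = Poly_Mapping.single (Poly_Mapping.single i 1) 1"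

definition const_term :: "mpol \<Rightarrow> rat" where
  "const_term f = Poly_Mapping.lookup f 0"

definition meval :: "(nat \<Rightarrow> rat) \<Rightarrow> mpol \<Rightarrow> rat" where
  "meval x f = (\<Sum>m\<in>Poly_Mapping.keys f. Poly_Mapping.lookup f m *
     (\<Prod>i\<in>Poly_Mapping.keys m. x i ^ Poly_Mapping.lookup m i))"

definition bell_index :: "nat \<Rightarrow> nat \<Rightarrow> (nat \<Rightarrow> nat) set" where
  "bell_index N k = {j \<in> {1..N - k + 1} \<rightarrow>\<^sub>E UNIV.
     (\<Sum>i=1..N - k + 1. i * j i) = N \<and> (\<Sum>i=1..N - k + 1. j i) = k}"

lemma finite_bell_index: "finite (bell_index N k)"
proof (rule finite_subset)
  show "bell_index N k \<subseteq> {1..N - k + 1} \<rightarrow>\<^sub>E {..k}"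
  proof
    fix j assume j: "j \<in> bell_index N k"
    have "j i \<le> k" if "i \<in> {1..N - k + 1}" for i
    proof -
      have "j i \<le> (\<Sum>i=1..N - k + 1. j i)"
        using that by (intro member_le_sum) auto
      then show ?thesis using j by (simp add: bell_index_def)
    qed
    then show "j \<in> {1..N - k + 1} \<rightarrow>\<^sub>E {..k}"
      using j unfolding bell_index_def PiE_def Pi_def by blast
  qed
  show "finite ({1..N - k + 1} \<rightarrow>\<^sub>E {..k})"
    by (intro finite_PiE) auto
qed

definition bell_partial :: "nat \<Rightarrow> nat \<Rightarrow> (nat \<Rightarrow> mpol) \<Rightarrow> mpol" where
  "bell_partial N k y = (\<Sum>j\<in>bell_index N k.
     mconst (fact N / (\<Prod>i=1..N - k + 1. fact (j i))) *
     (\<Prod>i=1..N - k + 1. (mconst (1 / fact i) * y i) ^ j i))"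

definition bell_complete :: "nat \<Rightarrow> (nat \<Rightarrow> mpol) \<Rightarrow> mpol" where
  "bell_complete N y = (\<Sum>k=1..N. bell_partial N k y)"

definition sigma_star :: "nat \<Rightarrow> mpol" where
  "sigma_star k = (- 1) ^ k * bell_complete k (\<lambda>i. - (mconst (fact (i - 1)) * mvar i))"

definition sigma_hat :: "nat \<Rightarrow> mpol" where
  "sigma_hat k = mconst (1 / fact k) * sigma_star k"

definition stirling1 :: "nat \<Rightarrow> nat \<Rightarrow> int" where
  "stirling1 N k = poly.coeff (\<Prod>i<N. [:- int i, 1:]) k"

lemma bell_partial_cong [fundef_cong]:
  assumes "N = N'" and "k = k'" and "\<And>i. i \<in> {1..N' - k' + 1} \<Longrightarrow> y i = y' i"
  shows "bell_partial N k y = bell_partial N' k' y'"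
  unfolding bell_partial_def using assms by (auto intro!: sum.cong prod.cong)

function psi :: "nat \<Rightarrow> mpol" where
  "psi N = (if N = 0 then 0 else
     of_nat N * psi (N - 1) + sigma_star N +
     (\<Sum>\<nu>=2..N. \<Sum>k=0..min \<nu> (N - \<nu>).
        mconst ((- 1) ^ (\<nu> + 1) * of_int (stirling1 (\<nu> + 1) (k + 1)) * (fact N / fact (N - k))) *
        bell_partial (N - k) \<nu> psi))"
  by auto
termination
  by (relation "measure id") auto

declare psi.simps [simp del]

definition fermat_quot :: "nat \<Rightarrow> nat \<Rightarrow> rat" where
  "fermat_quot p a = (of_nat a ^ (p - 1) - 1) / of_nat p"

definition fermat_quot_sum :: "nat \<Rightarrow> nat \<Rightarrow> rat" where
  "fermat_quot_sum p m = (\<Sum>a=1..p - 1. fermat_quot p a ^ m)"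

definition p_integral :: "nat \<Rightarrow> rat \<Rightarrow> bool" where
  "p_integral p x \<longleftrightarrow> coprime (snd (quotient_of x)) (int p)"

text \<open>The congruence \<open>x \<equiv> y (mod p\<^sup>l)\<close> in the ring of rationals with denominator prime to \<open>p\<close>.\<close>

definition rat_cong :: "nat \<Rightarrow> nat \<Rightarrow> rat \<Rightarrow> rat \<Rightarrow> bool" where
  "rat_cong p l x y \<longleftrightarrow> (\<exists>r. p_integral p r \<and> x - y = of_nat p ^ l * r)"

end

theory Submission
  imports Defs "HOL-Number_Theory.Residues"
begin

text \<open>
  Put \<open>a\<^sub>N = \<psi>\<^sub>N / N!\<close> and \<open>A(t) = \<Sum>\<^sub>N a\<^sub>N t ^ N\<close>. Partial Bell polynomials are the coefficients of
  powers, \<open>\<nu>! * B\<^sub>N\<^sub>,\<^sub>\<nu>(\<psi>) = N! * [t ^ N] A(t) ^ \<nu>\<close>, and the Stirling numbers \<open>S\<^sub>1(\<nu> + 1, k + 1)\<close> are the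
  coefficients of \<open>\<nu>! * (t - 1 choose \<nu>)\<close>. Hence the recurrence for \<open>\<psi>\<close> is the functional equation
  \<open>A = t A + \<Sum>\<^sub>N \<sigma>\<^sub>N t ^ N + \<Sum>\<^sub>\<nu>\<^sub>\<ge>\<^sub>2 (-1) ^ (\<nu> + 1) (t - 1 choose \<nu>) A ^ \<nu>\<close>, with \<open>\<sigma>\<^sub>N\<close> the polynomial
  \<open>sigma_hat N\<close>. All coefficients up to \<open>t ^ n\<close> are \<open>p\<close>-integral for \<open>n < p\<close>, so at \<open>t = p\<close> the number
  \<open>V = A(p) / p\<close> solves, modulo \<open>p ^ n\<close>, the equation of which the congruences for \<open>w\<^sub>l\<close> are the
  successive approximations. By induction \<open>w\<^sub>l \<equiv> V\<close> modulo \<open>p ^ l\<close>: in the term of index \<open>\<nu>\<close> the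
  factor \<open>p ^ \<nu>\<close> makes up for \<open>w\<^sub>l\<^sub>-\<^sub>\<nu>\<close> being known only modulo \<open>p ^ (l - \<nu>)\<close>.
\<close>

hide_const (open) Module.smult UnivPoly.coeff UnivPoly.monom

subsection \<open>Evaluation of polynomials\<close>

definition mon_eval :: "(nat \<Rightarrow> rat) \<Rightarrow> (nat \<Rightarrow>\<^sub>0 nat) \<Rightarrow> rat" where
  "mon_eval x m = (\<Prod>i\<in>Poly_Mapping.keys m. x i ^ Poly_Mapping.lookup m i)"

text \<open>Indices outside the support have exponent 0 and contribute a factor 1. This puts
  different monomials over one common index set.\<close>

lemma mon_eval_superset:
  assumes "finite I" "Poly_Mapping.keys m \<subseteq> I"
  shows "mon_eval x m = (\<Prod>i\<in>I. x i ^ Poly_Mapping.lookup m i)"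
  unfolding mon_eval_def using assms
  by (intro prod.mono_neutral_left) (auto simp: in_keys_iff)

lemma mon_eval_0 [simp]: "mon_eval x 0 = 1"
  by (simp add: mon_eval_def)

lemma mon_eval_add: "mon_eval x (m + m') = mon_eval x m * mon_eval x m'"
proof -
  let ?I = "Poly_Mapping.keys m \<union> Poly_Mapping.keys m'"
  have "mon_eval x (m + m') = (\<Prod>i\<in>?I. x i ^ Poly_Mapping.lookup (m + m') i)"
    by (intro mon_eval_superset) (auto simp: Poly_Mapping.keys_add)
  also have "\<dots> = (\<Prod>i\<in>?I. x i ^ Poly_Mapping.lookup m i) * (\<Prod>i\<in>?I. x i ^ Poly_Mapping.lookup m' i)"
    by (simp add: lookup_add power_add prod.distrib)
  also have "\<dots> = mon_eval x m * mon_eval x m'"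
    by (simp add: mon_eval_superset[of ?I])
  finally show ?thesis .
qed

lemma meval_mon_eval: "meval x f = (\<Sum>m\<in>Poly_Mapping.keys f. Poly_Mapping.lookup f m * mon_eval x m)"
  by (simp add: meval_def mon_eval_def)

lemma meval_superset:
  assumes "finite M" "Poly_Mapping.keys f \<subseteq> M"
  shows "meval x f = (\<Sum>m\<in>M. Poly_Mapping.lookup f m * mon_eval x m)"
  unfolding meval_mon_eval using assms
  by (intro sum.mono_neutral_left) (auto simp: in_keys_iff)

lemma meval_0 [simp]: "meval x 0 = 0"
  by (simp add: meval_def)

lemma meval_add [simp]: "meval x (f + g) = meval x f + meval x g"
proof -
  let ?M = "Poly_Mapping.keys f \<union> Poly_Mapping.keys g"
  have "meval x (f + g) = (\<Sum>m\<in>?M. Poly_Mapping.lookup (f + g) m * mon_eval x m)"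
    by (intro meval_superset) (auto simp: Poly_Mapping.keys_add)
  also have "\<dots> = meval x f + meval x g"
    by (simp add: meval_superset[of ?M] lookup_add ring_distribs sum.distrib)
  finally show ?thesis .
qed

lemma meval_uminus [simp]: "meval x (- f) = - meval x f"
  using meval_add[of x f "- f"] by simp

lemma meval_sum [simp]: "meval x (\<Sum>i\<in>I. f i) = (\<Sum>i\<in>I. meval x (f i))"
  by (induction I rule: infinite_finite_induct) auto

lemma meval_single: "meval x (Poly_Mapping.single m c) = c * mon_eval x m"
  by (cases "c = 0") (simp_all add: meval_mon_eval)

lemma mpol_eq_sum_single:
  "f = (\<Sum>m\<in>Poly_Mapping.keys f. Poly_Mapping.single m (Poly_Mapping.lookup f m))"
  by (rule poly_mapping_eqI)
    (simp add: lookup_sum lookup_single when_def in_keys_iff sum.delta)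

text \<open>The product is a convolution, so both factors are expanded into single terms, whose
  products add exponents; \<open>mon_eval_add\<close> then applies term by term.\<close>

lemma meval_mult [simp]: "meval x (f * g) = meval x f * meval x g"
proof -
  let ?s = "\<lambda>f m. Poly_Mapping.single m (Poly_Mapping.lookup f m) :: mpol"
  have "f * g = (\<Sum>m\<in>Poly_Mapping.keys f. \<Sum>m'\<in>Poly_Mapping.keys g. ?s f m * ?s g m')"
    by (subst mpol_eq_sum_single[of f], subst mpol_eq_sum_single[of g]) (rule sum_product)
  then show ?thesis
    by (simp add: mult_single meval_single mon_eval_add meval_mon_eval[of x f]
        meval_mon_eval[of x g] sum_product algebra_simps)
qed

lemma meval_mconst [simp]: "meval x (mconst c) = c"
  by (simp add: mconst_def meval_single)

lemma mconst_1 [simp]: "mconst 1 = 1"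
  by (simp add: mconst_def)

lemma meval_1 [simp]: "meval x 1 = 1"
  by (metis meval_mconst mconst_1)

lemma meval_mvar [simp]: "meval x (mvar i) = x i"
  by (simp add: mvar_def meval_single mon_eval_def)

lemma meval_of_nat [simp]: "meval x (of_nat n) = of_nat n"
  by (induction n) auto

lemma meval_power [simp]: "meval x (f ^ n) = meval x f ^ n"
  by (induction n) auto

lemma meval_prod [simp]: "meval x (\<Prod>i\<in>I. f i) = (\<Prod>i\<in>I. meval x (f i))"
  by (induction I rule: infinite_finite_induct) auto

text \<open>At the origin only the empty monomial survives, because \<open>0 ^ 0 = 1\<close>. The
  constant term thus inherits the homomorphism rules of \<open>meval\<close>.\<close>

lemma const_term_eq_meval: "const_term f = meval (\<lambda>_. 0) f"
proof -
  have "mon_eval (\<lambda>_. 0) m = (if m = 0 then 1 else 0)" for m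
  proof (cases "m = 0")
    case False
    then obtain i where "i \<in> Poly_Mapping.keys m"
      by (metis all_not_in_conv keys_eq_empty)
    then show ?thesis
      using False by (auto simp: mon_eval_def in_keys_iff intro!: prod_zero)
  qed simp
  then have "meval (\<lambda>_. 0) f =
      (\<Sum>m\<in>Poly_Mapping.keys f. if m = 0 then Poly_Mapping.lookup f m else 0)"
    unfolding meval_mon_eval by (intro sum.cong) auto
  then show ?thesis
    by (simp add: const_term_def in_keys_iff)
qed

section \<open>Constant terms and the first values of \<open>sigma_star\<close> and
  \<open>psi\<close>\<close>

lemma meval_bell_partial:
  "meval x (bell_partial N k y) = (\<Sum>j\<in>bell_index N k.
     fact N / (\<Prod>i=1..N - k + 1. fact (j i)) *
     (\<Prod>i=1..N - k + 1. (meval x (y i) / fact i) ^ j i))"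
  by (simp add: bell_partial_def)

text \<open>The exponents add up to \<open>k \<ge> 1\<close>, so every product contains a vanishing
  factor with positive exponent.\<close>

lemma meval_bell_partial_eq_0:
  assumes "k \<ge> 1" "\<And>i. i \<in> {1..N - k + 1} \<Longrightarrow> meval x (y i) = 0"
  shows "meval x (bell_partial N k y) = 0"
  unfolding meval_bell_partial
proof (intro sum.neutral ballI)
  fix j assume j: "j \<in> bell_index N k"
  then have "(\<Sum>i=1..N - k + 1. j i) \<noteq> 0"
    using assms(1) unfolding bell_index_def by simp
  then obtain i where i: "i \<in> {1..N - k + 1}" "j i \<noteq> 0"
    by (meson sum.neutral)
  then have "(\<Prod>i=1..N - k + 1. (meval x (y i) / fact i) ^ j i) = 0"
    using assms(2) by (intro prod_zero) auto
  then show "fact N / (\<Prod>i=1..N - k + 1. fact (j i)) *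
     (\<Prod>i=1..N - k + 1. (meval x (y i) / fact i) ^ j i) = 0" by simp
qed

lemma const_term_sigma_star:
  "const_term (sigma_star N) = 0"
  unfolding const_term_eq_meval sigma_star_def bell_complete_def
  by (simp add: meval_bell_partial_eq_0)

lemma const_term_psi: "const_term (psi N) = 0"
proof (induction N rule: less_induct)
  case (less N)
  \<comment> \<open>As \<open>\<nu> \<ge> 2\<close>, the arguments have index at most
    \<open>N - k - \<nu> + 1 < N\<close>, so the induction hypothesis covers them.\<close>
  have *: "meval (\<lambda>_. 0) (bell_partial (N - k) \<nu> psi) = 0"
    if "\<nu> \<in> {2..N}" "k \<in> {0..min \<nu> (N - \<nu>)}" for \<nu> k
    using that less by (intro meval_bell_partial_eq_0) (auto simp: const_term_eq_meval)
  show ?case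
    using less[of "N - 1"] const_term_sigma_star[of N] *
    by (subst psi.simps) (simp add: const_term_eq_meval sum.neutral)
qed

lemma sigma_star_1: "sigma_star 1 = mvar 1"
proof -
  have "bell_index 1 1 = {\<lambda>i. if i = 1 then 1 else undefined}"
    by (auto simp: bell_index_def PiE_def extensional_def)
  then show ?thesis
    by (simp add: sigma_star_def bell_complete_def bell_partial_def)
qed

lemma psi_0: "psi 0 = 0"
  by (subst psi.simps) simp

lemma psi_1: "psi 1 = mvar 1"
  using sigma_star_1 by (subst psi.simps) (simp add: psi_0)

subsection \<open>Rationals that are integral at \<open>p\<close>\<close>

text \<open>The definition refers to lowest terms, whereas sums and products produce unreduced
  fractions. The reduced denominator divides every other one, so coprimality to \<open>p\<close>
  passes down to it.\<close>

lemma p_integral_iff: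
  "p_integral p x \<longleftrightarrow> (\<exists>a b. b \<noteq> 0 \<and> coprime b (int p) \<and> x = of_int a / of_int b)"
proof
  assume "p_integral p x"
  then show "\<exists>a b. b \<noteq> 0 \<and> coprime b (int p) \<and> x = of_int a / of_int b"
    unfolding p_integral_def
    by (metis prod.collapse quotient_of_denom_pos' quotient_of_div less_irrefl)
next
  assume "\<exists>a b. b \<noteq> 0 \<and> coprime b (int p) \<and> x = of_int a / of_int b"
  then obtain a b where ab: "b \<noteq> 0" "coprime b (int p)" "x = of_int a / of_int b" by blast
  obtain n d where nd: "quotient_of x = (n, d)" by fastforce
  have "d > 0" "coprime n d" "x = of_int n / of_int d"
    using nd by (auto intro: quotient_of_denom_pos quotient_of_coprime quotient_of_div)
  then have "of_int (n * b) = (of_int (a * d) :: rat)"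
    using ab by (simp add: field_simps)
  then have "n * b = a * d" by (simp only: of_int_eq_iff)
  then have "d dvd b"
    using \<open>coprime n d\<close> by (metis coprime_commute coprime_dvd_mult_right_iff dvd_triv_right)
  then have "coprime d (int p)"
    using ab(2) by (rule coprime_divisors[OF _ dvd_refl])
  then show "p_integral p x"
    using nd by (simp add: p_integral_def)
qed

lemma p_integral_of_int [simp]: "p_integral p (of_int a)"
  unfolding p_integral_iff by (intro exI[of _ a] exI[of _ 1]) auto

lemma p_integral_of_nat [simp]: "p_integral p (of_nat a)"
  by (metis of_int_of_nat_eq p_integral_of_int)

lemma p_integral_0 [simp]: "p_integral p 0" and p_integral_1 [simp]: "p_integral p 1"
  using p_integral_of_int[of p 0] p_integral_of_int[of p 1] by auto

lemma p_integral_fact [simp]: "p_integral p (fact n)"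
  by (metis of_nat_fact p_integral_of_nat)

lemma p_integral_add: "p_integral p x \<Longrightarrow> p_integral p y \<Longrightarrow> p_integral p (x + y)"
  unfolding p_integral_iff
proof (elim exE conjE)
  fix a b c d :: int
  assume "b \<noteq> 0" "d \<noteq> 0" "coprime b (int p)" "coprime d (int p)"
    "x = of_int a / of_int b" "y = of_int c / of_int d"
  then show "\<exists>a b. b \<noteq> 0 \<and> coprime b (int p) \<and> x + y = of_int a / of_int b"
    by (intro exI[of _ "a * d + c * b"] exI[of _ "b * d"]) (auto simp: field_simps)
qed

lemma p_integral_mult: "p_integral p x \<Longrightarrow> p_integral p y \<Longrightarrow> p_integral p (x * y)"
  unfolding p_integral_iff
proof (elim exE conjE)
  fix a b c d :: int
  assume "b \<noteq> 0" "d \<noteq> 0" "coprime b (int p)" "coprime d (int p)"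
    "x = of_int a / of_int b" "y = of_int c / of_int d"
  then show "\<exists>a b. b \<noteq> 0 \<and> coprime b (int p) \<and> x * y = of_int a / of_int b"
    by (intro exI[of _ "a * c"] exI[of _ "b * d"]) auto
qed

lemma p_integral_uminus: "p_integral p x \<Longrightarrow> p_integral p (- x)"
  using p_integral_mult[of p "of_int (- 1)" x] p_integral_of_int[of p "- 1"] by simp

lemma p_integral_diff: "p_integral p x \<Longrightarrow> p_integral p y \<Longrightarrow> p_integral p (x - y)"
  using p_integral_add[of p x "- y"] p_integral_uminus[of p y] by simp

lemma p_integral_power: "p_integral p x \<Longrightarrow> p_integral p (x ^ n)"
  by (induction n) (auto intro: p_integral_mult)

lemma p_integral_sum: "(\<And>i. i \<in> I \<Longrightarrow> p_integral p (f i)) \<Longrightarrow> p_integral p (\<Sum>i\<in>I. f i)"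
  by (induction I rule: infinite_finite_induct) (auto intro: p_integral_add)

lemma p_integral_prod: "(\<And>i. i \<in> I \<Longrightarrow> p_integral p (f i)) \<Longrightarrow> p_integral p (\<Prod>i\<in>I. f i)"
  by (induction I rule: infinite_finite_induct) (auto intro: p_integral_mult)

section \<open>Integrality of \<open>sigma_star\<close>, \<open>sigma_hat\<close>,
  \<open>psi\<close> and the Fermat quotient sums\<close>

lemma p_integral_inverse_fact:
  assumes "prime p" "n < p"
  shows "p_integral p (1 / fact n)"
proof -
  have "coprime (fact n) p"
    using assms by (metis coprime_commute prime_imp_coprime prime_dvd_fact_iff not_le)
  then have "coprime (int (fact n)) (int p)" by (simp only: coprime_int_iff)
  then show ?thesis
    unfolding p_integral_iff by (intro exI[of _ 1] exI[of _ "int (fact n)"]) auto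
qed

lemma p_integral_divide_fact:
  assumes "prime p" "n < p" "p_integral p x"
  shows "p_integral p (x / fact n)"
  using p_integral_mult[OF assms(3) p_integral_inverse_fact[OF assms(1,2)]] by simp

text \<open>Only factorials of the exponents \<open>j i \<le> k\<close> and of the indices
  \<open>i \<le> N - k + 1\<close> occur as denominators. Both bounds are at most
  \<open>N < p\<close>, so these factorials are prime to \<open>p\<close>.\<close>

lemma p_integral_bell_partial:
  assumes "prime p" "N < p" "1 \<le> k" "k \<le> N"
    and y: "\<And>i. i \<in> {1..N - k + 1} \<Longrightarrow> p_integral p (meval x (y i))"
  shows "p_integral p (meval x (bell_partial N k y))"
  unfolding meval_bell_partial
proof (intro p_integral_sum p_integral_mult p_integral_prod p_integral_power)
  fix j assume j: "j \<in> bell_index N k"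
  have "j i < p" if "i \<in> {1..N - k + 1}" for i
    using j that member_le_sum[of i "{1..N - k + 1}" j] assms by (simp add: bell_index_def)
  then have "p_integral p (fact N * (\<Prod>i=1..N - k + 1. 1 / fact (j i)))"
    by (intro p_integral_mult p_integral_prod p_integral_inverse_fact assms(1) p_integral_fact)
  then show "p_integral p (fact N / (\<Prod>i=1..N - k + 1. fact (j i)))"
    by (simp add: prod_dividef)
next
  fix i assume "i \<in> {1..N - k + 1}"
  then show "p_integral p (meval x (y i) / fact i)"
    using assms by (intro p_integral_divide_fact) auto
qed

lemma p_integral_sigma_star:
  assumes "prime p" "N < p" "\<And>i. p_integral p (x i)"
  shows "p_integral p (meval x (sigma_star N))"
  using assms unfolding sigma_star_def bell_complete_def meval_mult meval_power meval_sum
  by (intro p_integral_mult p_integral_power p_integral_sum p_integral_bell_partial)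
    (auto intro!: p_integral_mult p_integral_uminus)

lemma p_integral_sigma_hat:
  assumes "prime p" "N < p" "\<And>i. p_integral p (x i)"
  shows "p_integral p (meval x (sigma_hat N))"
  unfolding sigma_hat_def meval_mult meval_mconst using assms
  by (intro p_integral_mult p_integral_inverse_fact p_integral_sigma_star)

lemma p_integral_psi:
  assumes "prime p" "\<And>i. p_integral p (x i)"
  shows "N < p \<Longrightarrow> p_integral p (meval x (psi N))"
proof (induction N rule: less_induct)
  case (less N)
  show ?case
  proof (cases "N = 0")
    case False
    then have "p_integral p (meval x (psi (N - 1)))"
      using less by auto
    moreover have "p_integral p (meval x (mconst ((- 1) ^ (\<nu> + 1) *
        of_int (stirling1 (\<nu> + 1) (k + 1)) * (fact N / fact (N - k))) * bell_partial (N - k) \<nu> psi))"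
      if "\<nu> \<in> {2..N}" "k \<in> {0..min \<nu> (N - \<nu>)}" for \<nu> k
      using that less assms(1) unfolding meval_mult meval_mconst
      by (intro p_integral_mult p_integral_power p_integral_divide_fact p_integral_bell_partial)
         (auto intro: p_integral_uminus)
    ultimately show ?thesis
      using False less.prems assms
      by (subst psi.simps)
        (auto simp del: meval_mult meval_mconst simp: meval_mult[of _ "of_nat _"]
          intro!: p_integral_add p_integral_mult p_integral_sum p_integral_sigma_star)
  qed (simp add: psi_0)
qed

text \<open>By Fermat's little theorem the quotient is an integer.\<close>

lemma p_integral_fermat_quot:
  assumes "prime p" "1 \<le> a" "a < p"
  shows "p_integral p (fermat_quot p a)"
proof -
  have "[a ^ (p - 1) = 1] (mod p)"
    using assms by (intro fermat_theorem) (auto dest: dvd_imp_le)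
  then have "[int a ^ (p - 1) = 1] (mod int p)"
    by (metis cong_int_iff of_nat_1 of_nat_power)
  then obtain c where "int a ^ (p - 1) - 1 = int p * c"
    by (metis cong_iff_dvd_diff dvdE)
  then have "(of_int (int a ^ (p - 1) - 1) :: rat) = of_int (int p * c)" by simp
  then have "fermat_quot p a = of_int c"
    using assms(1) prime_gt_0_nat[OF assms(1)] by (simp add: fermat_quot_def field_simps)
  then show ?thesis by simp
qed

lemma p_integral_fermat_quot_sum:
  assumes "prime p"
  shows "p_integral p (fermat_quot_sum p m)"
  unfolding fermat_quot_sum_def using assms prime_gt_0_nat[OF assms]
  by (intro p_integral_sum p_integral_power p_integral_fermat_quot) auto

subsection \<open>Congruences of \<open>p\<close>-integral rationals\<close>

lemma rat_cong_refl [simp]: "rat_cong p l x x"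
  unfolding rat_cong_def by (intro exI[of _ 0]) simp

lemma rat_cong_sym: "rat_cong p l x y \<Longrightarrow> rat_cong p l y x"
  unfolding rat_cong_def
  by (metis minus_diff_eq mult_minus_right p_integral_uminus)

lemma rat_cong_add:
  "rat_cong p l x y \<Longrightarrow> rat_cong p l x' y' \<Longrightarrow> rat_cong p l (x + x') (y + y')"
  unfolding rat_cong_def
  by (metis add_diff_add distrib_left p_integral_add)

lemma rat_cong_trans [trans]: "rat_cong p l x y \<Longrightarrow> rat_cong p l y z \<Longrightarrow> rat_cong p l x z"
  using rat_cong_add[of p l x y y z] unfolding rat_cong_def by simp

lemma rat_cong_sum:
  "(\<And>i. i \<in> I \<Longrightarrow> rat_cong p l (f i) (g i)) \<Longrightarrow> rat_cong p l (\<Sum>i\<in>I. f i) (\<Sum>i\<in>I. g i)"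
  by (induction I rule: infinite_finite_induct) (auto intro: rat_cong_add)

text \<open>The asymmetric integrality hypotheses come from the splitting
  \<open>x * x' - y * y' = (x - y) * x' + y * (x' - y')\<close>.\<close>

lemma rat_cong_mult:
  assumes "rat_cong p l x y" "rat_cong p l x' y'" "p_integral p x'" "p_integral p y"
  shows "rat_cong p l (x * x') (y * y')"
proof -
  obtain r r' where r: "p_integral p r" "x - y = of_nat p ^ l * r"
    and r': "p_integral p r'" "x' - y' = of_nat p ^ l * r'"
    using assms(1,2) unfolding rat_cong_def by blast
  have "x * x' - y * y' = (x - y) * x' + y * (x' - y')"
    by (simp add: algebra_simps)
  also have "\<dots> = of_nat p ^ l * (r * x' + y * r')"
    unfolding r r' by (simp add: algebra_simps)
  finally show ?thesis
    unfolding rat_cong_def using r r' assms(3,4) by (blast intro: p_integral_add p_integral_mult)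
qed

lemma rat_cong_power:
  assumes "rat_cong p l x y" "p_integral p x" "p_integral p y"
  shows "rat_cong p l (x ^ k) (y ^ k)"
  by (induction k) (auto intro: rat_cong_mult assms p_integral_power)

lemma rat_cong_scale:
  "rat_cong p l x y \<Longrightarrow> rat_cong p (k + l) (of_nat p ^ k * x) (of_nat p ^ k * y)"
  unfolding rat_cong_def
  by (metis mult.assoc power_add right_diff_distrib)

lemma rat_cong_cancel:
  "p > 0 \<Longrightarrow> rat_cong p (Suc l) (of_nat p * x) (of_nat p * y) \<Longrightarrow> rat_cong p l x y"
  unfolding rat_cong_def by (auto simp flip: right_diff_distrib simp: mult.assoc)

lemma rat_cong_mono:
  assumes "rat_cong p l x y" "l' \<le> l"
  shows "rat_cong p l' x y"
proof -
  obtain r where r: "p_integral p r" "x - y = of_nat p ^ l * r"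
    using assms(1) unfolding rat_cong_def by blast
  have "x - y = of_nat p ^ l' * (of_nat p ^ (l - l') * r)"
    using r(2) assms(2) by (simp flip: mult.assoc power_add)
  then show ?thesis
    unfolding rat_cong_def using r(1) by (blast intro: p_integral_mult p_integral_power p_integral_of_nat)
qed

lemma rat_cong_multiple_0:
  assumes "p_integral p r" "l \<le> k"
  shows "rat_cong p l (of_nat p ^ k * r) 0"
proof (rule rat_cong_mono[OF _ assms(2)])
  show "rat_cong p k (of_nat p ^ k * r) 0"
    unfolding rat_cong_def using assms(1) by auto
qed

text \<open>Every dropped term carries at least the factor \<open>p ^ (l + 1)\<close>; hence the
  modulus is one power better than the last index kept.\<close>

lemma rat_cong_sum_truncate:
  assumes "\<And>i. i \<in> {1..n} \<Longrightarrow> p_integral p (f i)" "l \<le> n"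
  shows "rat_cong p (Suc l) (\<Sum>i=1..n. of_nat p ^ i * f i) (\<Sum>i=1..l. of_nat p ^ i * f i)"
proof -
  have "(\<Sum>i=1..n. of_nat p ^ i * f i) =
      (\<Sum>i=1..l. of_nat p ^ i * f i) + (\<Sum>i=Suc l..n. of_nat p ^ i * f i)"
    using assms(2) sum.ub_add_nat[of 1 l "\<lambda>i. of_nat p ^ i * f i" "n - l"] by simp
  moreover have "rat_cong p (Suc l) (\<Sum>i=Suc l..n. of_nat p ^ i * f i) (\<Sum>i=Suc l..n. 0)"
    using assms by (intro rat_cong_sum rat_cong_multiple_0) auto
  ultimately show ?thesis
    using rat_cong_add[of p "Suc l" _ _ _ 0] by fastforce
qed

subsection \<open>Bell polynomials as coefficients of powers\<close>

text \<open>These are the exponent vectors of the multinomial theorem. \<open>bell_index\<close> is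
  the subset cut out by the additional weight condition.\<close>

definition compositions_on :: "'a set \<Rightarrow> nat \<Rightarrow> ('a \<Rightarrow> nat) set" where
  "compositions_on I k = {j \<in> I \<rightarrow>\<^sub>E UNIV. sum j I = k}"

lemma compositions_on_empty: "compositions_on {} k = (if k = 0 then {\<lambda>_. undefined} else {})"
  by (auto simp: compositions_on_def)

lemma finite_compositions_on: "finite I \<Longrightarrow> finite (compositions_on I k)"
proof (rule finite_subset)
  assume I: "finite I"
  show "compositions_on I k \<subseteq> I \<rightarrow>\<^sub>E {..k}"
    using I by (auto simp: compositions_on_def PiE_def Pi_def intro: member_le_sum)
  show "finite (I \<rightarrow>\<^sub>E {..k})"
    using I by (intro finite_PiE) auto
qed

lemma sum_compositions_on_insert:
  assumes "finite I" "a \<notin> I"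
  shows "(\<Sum>j\<in>compositions_on (insert a I) k. g j) =
    (\<Sum>m\<le>k. \<Sum>j\<in>compositions_on I (k - m). g (j(a := m)))"
proof -
  have "(\<Sum>j\<in>compositions_on (insert a I) k. g j) =
      (\<Sum>(m, j)\<in>Sigma {..k} (\<lambda>m. compositions_on I (k - m)). g (j(a := m)))"
  \<comment> \<open>The value at \<open>a\<close> is split off. Resetting it to
    \<open>undefined\<close> makes the remaining function extensional on \<open>I\<close>.\<close>
  proof (rule sum.reindex_bij_witness[where i = "\<lambda>(m, j). j(a := m)"
        and j = "\<lambda>j. (j a, j(a := undefined))"])
    fix j assume j: "j \<in> compositions_on (insert a I) k"
    have "sum (j(a := undefined)) I = sum j I"
      using assms by (intro sum.cong) auto
    then show "(j a, j(a := undefined)) \<in> Sigma {..k} (\<lambda>m. compositions_on I (k - m))"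
      using j assms by (auto simp: compositions_on_def PiE_def extensional_def)
  next
    fix mj assume "mj \<in> Sigma {..k} (\<lambda>m. compositions_on I (k - m))"
    then obtain m j where mj: "mj = (m, j)" "m \<le> k" "j \<in> compositions_on I (k - m)" by auto
    have "sum (j(a := m)) I = sum j I"
      using assms by (intro sum.cong) auto
    then show "(case mj of (m, j) \<Rightarrow> j(a := m)) \<in> compositions_on (insert a I) k"
      using mj assms by (auto simp: compositions_on_def PiE_def extensional_def)
    show "((case mj of (m, j) \<Rightarrow> j(a := m)) a, (case mj of (m, j) \<Rightarrow> j(a := m))(a := undefined)) = mj"
      using mj assms by (auto simp: compositions_on_def PiE_def extensional_def fun_eq_iff)
  qed auto
  also have "\<dots> = (\<Sum>m\<le>k. \<Sum>j\<in>compositions_on I (k - m). g (j(a := m)))"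
    using assms by (subst sum.Sigma) (auto intro: finite_compositions_on)
  finally show ?thesis .
qed

lemma smult_sum_right: "smult c (\<Sum>i\<in>I. f i) = (\<Sum>i\<in>I. smult c (f i))"
  by (induction I rule: infinite_finite_induct) (auto simp: smult_add_right)

text \<open>With divided powers \<open>f ^ k / k!\<close> the multinomial coefficients disappear:
  the induction step is the binomial theorem with
  \<open>(k choose m) / k! = 1 / (m! (k - m)!)\<close>.\<close>

lemma multinomial_poly:
  fixes f :: "'a \<Rightarrow> 'b :: field_char_0 poly"
  assumes "finite I"
  shows "smult (1 / fact k) ((\<Sum>i\<in>I. f i) ^ k) =
    (\<Sum>j\<in>compositions_on I k. \<Prod>i\<in>I. smult (1 / fact (j i)) (f i ^ j i))"
  using assms
proof (induction I arbitrary: k rule: finite_induct)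
  case empty
  show ?case by (simp add: compositions_on_empty power_0_left)
next
  case (insert a I)
  let ?t = "\<lambda>j i. smult (1 / fact (j i)) (f i ^ j i)"
  have "smult (1 / fact k) ((\<Sum>i\<in>insert a I. f i) ^ k) =
      smult (1 / fact k) ((f a + (\<Sum>i\<in>I. f i)) ^ k)"
    using insert by simp
  also have "\<dots> = (\<Sum>m\<le>k. smult (1 / fact k) (of_nat (k choose m) * f a ^ m * (\<Sum>i\<in>I. f i) ^ (k - m)))"
    by (simp add: binomial_ring smult_sum_right)
  also have "\<dots> = (\<Sum>m\<le>k. smult (1 / fact m) (f a ^ m) * smult (1 / fact (k - m)) ((\<Sum>i\<in>I. f i) ^ (k - m)))"
    by (intro sum.cong refl)
      (simp add: binomial_fact of_nat_poly mult_ac)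
  also have "\<dots> = (\<Sum>m\<le>k. \<Sum>j\<in>compositions_on I (k - m). smult (1 / fact m) (f a ^ m) * (\<Prod>i\<in>I. ?t j i))"
    by (simp only: insert.IH sum_distrib_left)
  also have "\<dots> = (\<Sum>m\<le>k. \<Sum>j\<in>compositions_on I (k - m). \<Prod>i\<in>insert a I. ?t (j(a := m)) i)"
  proof (intro sum.cong refl)
    fix m j
    have "(\<Prod>i\<in>I. ?t (j(a := m)) i) = (\<Prod>i\<in>I. ?t j i)"
      using insert by (intro prod.cong) auto
    then show "smult (1 / fact m) (f a ^ m) * (\<Prod>i\<in>I. ?t j i) = (\<Prod>i\<in>insert a I. ?t (j(a := m)) i)"
      using insert by simp
  qed
  also have "\<dots> = (\<Sum>j\<in>compositions_on (insert a I) k. \<Prod>i\<in>insert a I. ?t j i)"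
    using insert by (subst sum_compositions_on_insert) auto
  finally show ?case .
qed

lemma prod_monom:
  "(\<Prod>i\<in>I. monom (c i) (d i)) = monom (\<Prod>i\<in>I. c i :: 'a :: comm_semiring_1) (\<Sum>i\<in>I. d i)"
  by (induction I rule: infinite_finite_induct) (auto simp: mult_monom monom_0 one_pCons)

text \<open>For monomials each multinomial term is a single monomial of degree
  \<open>\<Sum>i. i * j i\<close>. Extracting degree \<open>N\<close> therefore imposes exactly the
  missing condition of \<open>bell_index\<close>.\<close>

lemma coeff_power_monom_sum_bell_index:
  fixes c :: "nat \<Rightarrow> rat"
  shows "coeff ((\<Sum>i=1..N - k + 1. monom (c i) i) ^ k) N =
    fact k * (\<Sum>j\<in>bell_index N k. (\<Prod>i=1..N - k + 1. c i ^ j i / fact (j i)))"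
proof -
  let ?I = "{1..N - k + 1}"
  let ?c = "\<lambda>j. \<Prod>i\<in>?I. c i ^ j i / fact (j i)"
  have "smult (1 / fact k) ((\<Sum>i\<in>?I. monom (c i) i) ^ k) =
      (\<Sum>j\<in>compositions_on ?I k. \<Prod>i\<in>?I. smult (1 / fact (j i)) (monom (c i) i ^ j i))"
    by (rule multinomial_poly) simp
  also have "\<dots> = (\<Sum>j\<in>compositions_on ?I k. monom (?c j) (\<Sum>i\<in>?I. i * j i))"
    by (simp add: monom_power smult_monom prod_monom)
  finally have "coeff (smult (1 / fact k) ((\<Sum>i\<in>?I. monom (c i) i) ^ k)) N =
      (\<Sum>j\<in>compositions_on ?I k. if (\<Sum>i\<in>?I. i * j i) = N then ?c j else 0)"
    by (simp only: coeff_sum coeff_monom)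
  also have "\<dots> = (\<Sum>j\<in>{j \<in> compositions_on ?I k. (\<Sum>i\<in>?I. i * j i) = N}. ?c j)"
    by (rule sum.inter_filter[symmetric]) (simp add: finite_compositions_on)
  also have "{j \<in> compositions_on ?I k. (\<Sum>i\<in>?I. i * j i) = N} = bell_index N k"
    by (auto simp: compositions_on_def bell_index_def)
  finally show ?thesis
    by (simp add: field_simps)
qed

lemma X_dvd_sum_monom: "monom 1 1 dvd (\<Sum>i=1..n. monom (c i :: 'a :: comm_semiring_1) i)"
  by (intro dvd_sum) (simp add: monom_1_dvd_iff')

text \<open>A sum without constant term has a \<open>k\<close>-th power starting at degree
  \<open>k\<close>. This matches the bounds on \<open>\<nu>\<close> and \<open>k\<close> in the
  recurrence for \<open>psi\<close>.\<close>

lemma coeff_power_monom_sum_eq_0: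
  fixes c :: "nat \<Rightarrow> 'a :: comm_ring_1"
  assumes "N < k"
  shows "coeff ((\<Sum>i=1..n. monom (c i) i) ^ k) N = 0"
proof -
  have "monom 1 k dvd (\<Sum>i=1..n. monom (c i) i) ^ k"
    using dvd_power_same[OF X_dvd_sum_monom[of c n], of k] by (simp add: monom_power)
  then show ?thesis using assms by (simp add: monom_1_dvd_iff')
qed

text \<open>Raising \<open>n\<close> beyond \<open>M\<close> changes the \<open>k\<close>-th power by multiples of \<open>X ^ (M + 1) * X ^ (k - 1)\<close>.\<close>

lemma coeff_power_monom_sum_truncate:
  fixes c :: "nat \<Rightarrow> 'a :: comm_ring_1"
  assumes "1 \<le> k" "N - k + 1 \<le> n" "k \<le> N"
  shows "coeff ((\<Sum>i=1..n. monom (c i) i) ^ k) N = coeff ((\<Sum>i=1..N - k + 1. monom (c i) i) ^ k) N"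
proof -
  define M where "M = N - k + 1"
  define A where "A = (\<Sum>i=1..n. monom (c i) i)"
  define B where "B = (\<Sum>i=1..M. monom (c i) i)"
  obtain k' where k: "k = Suc k'" using assms(1) by (cases k) auto
  have "A = B + (\<Sum>i=Suc M..n. monom (c i) i)"
    using assms sum.ub_add_nat[of 1 M "\<lambda>i. monom (c i) i" "n - M"] by (simp add: A_def B_def M_def)
  moreover have "monom 1 (Suc M) dvd (\<Sum>i=Suc M..n. monom (c i) i)"
    by (intro dvd_sum) (simp add: monom_1_dvd_iff')
  ultimately have 1: "monom 1 (Suc M) dvd A - B" by simp
  have "monom 1 k' dvd A ^ i * B ^ (k' - i)" if "i < Suc k'" for i
  proof -
    have "monom 1 1 ^ i * monom 1 1 ^ (k' - i) dvd A ^ i * B ^ (k' - i)"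
      unfolding A_def B_def by (intro mult_dvd_mono dvd_power_same X_dvd_sum_monom)
    then show ?thesis using that by (simp add: monom_power mult_monom)
  qed
  then have "monom 1 k' dvd (\<Sum>i<Suc k'. A ^ i * B ^ (k' - i))"
    by (intro dvd_sum) auto
  then have "monom 1 (Suc M) * monom 1 k' dvd (A - B) * (\<Sum>i<Suc k'. A ^ i * B ^ (k' - i))"
    using 1 by (intro mult_dvd_mono)
  also have "(A - B) * (\<Sum>i<Suc k'. A ^ i * B ^ (k' - i)) = A ^ k - B ^ k"
    unfolding k by (subst power_diff_sumr2) (simp add: algebra_simps)
  also have "monom 1 (Suc M) * monom 1 k' = monom (1 :: 'a) (Suc N)"
    using assms k by (simp add: mult_monom M_def)
  finally have "coeff (A ^ k - B ^ k) N = 0"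
    by (simp add: monom_1_dvd_iff')
  then show ?thesis by (simp add: A_def B_def M_def)
qed

text \<open>The bound \<open>n\<close> is free, so powers of one fixed polynomial represent all the
  Bell polynomials of the recurrence at once.\<close>

lemma meval_bell_partial_eq_coeff:
  assumes "1 \<le> k" "k \<le> N" "N - k + 1 \<le> n"
  shows "meval x (bell_partial N k y) =
    fact N / fact k * coeff ((\<Sum>i=1..n. monom (meval x (y i) / fact i) i) ^ k) N"
  unfolding coeff_power_monom_sum_truncate[OF assms(1,3,2)] coeff_power_monom_sum_bell_index
    meval_bell_partial
  by (simp add: sum_distrib_left prod_dividef)

text \<open>This is \<open>(t - 1 choose \<nu>)\<close> in powers of \<open>t\<close>: the product
  \<open>t (t - 1) ... (t - \<nu>)\<close> divided by \<open>t\<close> and by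
  \<open>\<nu>!\<close>.\<close>

definition shifted_binomial_poly :: "nat \<Rightarrow> rat poly" where
  "shifted_binomial_poly \<nu> = (\<Sum>k\<le>\<nu>. monom (of_int (stirling1 (\<nu> + 1) (k + 1)) / fact \<nu>) k)"

lemma coeff_shifted_binomial_poly:
  "coeff (shifted_binomial_poly \<nu>) k =
    (if k \<le> \<nu> then of_int (stirling1 (\<nu> + 1) (k + 1)) / fact \<nu> else 0)"
  by (simp add: shifted_binomial_poly_def coeff_sum)

lemma poly_shifted_binomial_poly:
  assumes "p > 0"
  shows "poly (shifted_binomial_poly \<nu>) (of_nat p) = of_nat ((p - 1) choose \<nu>)"
proof -
  define q where "q = (\<Prod>i<\<nu>. [:- int (Suc i), 1:])"
  \<comment> \<open>The factor for \<open>i = 0\<close> is the variable itself. Splitting it off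
    lowers degrees by one, which explains the index \<open>k + 1\<close> of the Stirling
    numbers.\<close>
  have "(\<Prod>i<\<nu> + 1. [:- int i, 1:]) = pCons 0 q"
    unfolding q_def by (simp add: prod.lessThan_Suc_shift del: prod.lessThan_Suc of_nat_Suc)
  then have stirling: "stirling1 (Suc \<nu>) (Suc k) = coeff q k" for k
    by (simp add: stirling1_def)
  have "degree q \<le> \<nu>"
    unfolding q_def using degree_prod_sum_le[of "{..<\<nu>}" "\<lambda>i. [:- int (Suc i), 1:]"]
    by (simp del: of_nat_Suc)
  then have "poly q (int p) = (\<Sum>k\<le>\<nu>. coeff q k * int p ^ k)"
    unfolding poly_altdef by (intro sum.mono_neutral_left) (auto simp: coeff_eq_0)
  moreover have "poly q (int p) = (\<Prod>i<\<nu>. int (p - 1) - int i)"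
    using assms unfolding q_def poly_prod by (intro prod.cong) (auto simp: of_nat_diff)
  ultimately have "(\<Sum>k\<le>\<nu>. of_int (coeff q k) * of_nat p ^ k :: rat) = of_int (\<Prod>i<\<nu>. int (p - 1) - int i)"
    by (metis (no_types, lifting) of_int_mult of_int_of_nat_eq of_int_power of_int_sum sum.cong)
  then show ?thesis
    by (simp add: shifted_binomial_poly_def poly_sum poly_monom stirling binomial_gbinomial
        gbinomial_prod_rev atLeast0LessThan flip: sum_divide_distrib)
qed

subsection \<open>The functional equation\<close>

text \<open>The inner sum of \<open>\<Psi>\<^sub>N\<close> is the coefficient of \<open>t ^ N\<close> in \<open>(t - 1 choose \<nu>) * A(t) ^ \<nu>\<close>, where
  \<open>A\<close> is the exponential generating function of \<open>\<psi>\<close>.\<close>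

lemma coeff_shifted_binomial_poly_mult_power:
  fixes x :: "nat \<Rightarrow> rat"
  defines "a \<equiv> \<lambda>i. meval x (psi i) / fact i"
  assumes "2 \<le> \<nu>" "\<nu> \<le> N" "N \<le> n"
  shows "coeff (shifted_binomial_poly \<nu> * (\<Sum>i=1..n. monom (a i) i) ^ \<nu>) N =
    (\<Sum>k=0..min \<nu> (N - \<nu>). of_int (stirling1 (\<nu> + 1) (k + 1)) *
       (meval x (bell_partial (N - k) \<nu> psi) / fact (N - k)))"
proof -
  let ?A = "\<Sum>i=1..n. monom (a i) i"
  have "coeff (shifted_binomial_poly \<nu> * ?A ^ \<nu>) N =
      (\<Sum>k\<le>N. coeff (shifted_binomial_poly \<nu>) k * coeff (?A ^ \<nu>) (N - k))"
    by (rule coeff_mult)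
  also have "\<dots> = (\<Sum>k=0..min \<nu> (N - \<nu>). coeff (shifted_binomial_poly \<nu>) k * coeff (?A ^ \<nu>) (N - k))"
  proof (rule sum.mono_neutral_right)
    show "\<forall>k\<in>{..N} - {0..min \<nu> (N - \<nu>)}. coeff (shifted_binomial_poly \<nu>) k * coeff (?A ^ \<nu>) (N - k) = 0"
    proof
      fix k assume "k \<in> {..N} - {0..min \<nu> (N - \<nu>)}"
      \<comment> \<open>Either \<open>k\<close> exceeds the degree bound of the binomial polynomial,
        or \<open>N - k\<close> lies below the lowest degree of the power.\<close>
      then have "\<nu> < k \<or> N - k < \<nu>" using assms by auto
      then show "coeff (shifted_binomial_poly \<nu>) k * coeff (?A ^ \<nu>) (N - k) = 0"
        using coeff_power_monom_sum_eq_0[of "N - k" \<nu> a n]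
        by (auto simp: coeff_shifted_binomial_poly)
    qed
  qed auto
  also have "\<dots> = (\<Sum>k=0..min \<nu> (N - \<nu>). of_int (stirling1 (\<nu> + 1) (k + 1)) *
       (meval x (bell_partial (N - k) \<nu> psi) / fact (N - k)))"
  proof (rule sum.cong[OF refl])
    fix k assume k: "k \<in> {0..min \<nu> (N - \<nu>)}"
    have "meval x (bell_partial (N - k) \<nu> psi) = fact (N - k) / fact \<nu> * coeff (?A ^ \<nu>) (N - k)"
      unfolding a_def using k assms by (intro meval_bell_partial_eq_coeff) auto
    then show "coeff (shifted_binomial_poly \<nu>) k * coeff (?A ^ \<nu>) (N - k) =
        of_int (stirling1 (\<nu> + 1) (k + 1)) * (meval x (bell_partial (N - k) \<nu> psi) / fact (N - k))"
      using k by (simp add: coeff_shifted_binomial_poly)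
  qed
  finally show ?thesis .
qed

text \<open>This is the recurrence divided by \<open>fact N\<close>. The falling factorial
  \<open>fact N / fact (N - k)\<close> leaves \<open>1 / fact (N - k)\<close>, the normalisation
  that turns Bell polynomials into coefficients.\<close>

lemma meval_psi_recurrence:
  fixes x :: "nat \<Rightarrow> rat"
  defines "a \<equiv> \<lambda>i. meval x (psi i) / fact i"
  assumes "1 \<le> N" "N \<le> n"
  shows "a N = a (N - 1) + meval x (sigma_hat N) +
    (\<Sum>\<nu>=2..n. (- 1) ^ (\<nu> + 1) * coeff (shifted_binomial_poly \<nu> * (\<Sum>i=1..n. monom (a i) i) ^ \<nu>) N)"
proof -
  let ?B = "\<lambda>\<nu>. coeff (shifted_binomial_poly \<nu> * (\<Sum>i=1..n. monom (a i) i) ^ \<nu>) N"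
  let ?S = "\<Sum>\<nu>=2..N. \<Sum>k=0..min \<nu> (N - \<nu>). (- 1) ^ (\<nu> + 1) * of_int (stirling1 (\<nu> + 1) (k + 1)) *
      (fact N / fact (N - k)) * meval x (bell_partial (N - k) \<nu> psi)"
  have zero: "?B \<nu> = 0" if "\<nu> > N" for \<nu>
    unfolding coeff_mult
  proof (intro sum.neutral ballI)
    show "coeff (shifted_binomial_poly \<nu>) k * coeff ((\<Sum>i=1..n. monom (a i) i) ^ \<nu>) (N - k) = 0" for k
      using that coeff_power_monom_sum_eq_0[of "N - k" \<nu> a n] by simp
  qed
  have "meval x (psi N) = of_nat N * meval x (psi (N - 1)) + meval x (sigma_star N) + ?S"
    using assms by (subst psi.simps) (simp add: mult.assoc)
  then have "a N = of_nat N * meval x (psi (N - 1)) / fact N + meval x (sigma_star N) / fact N + ?S / fact N"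
    by (simp add: a_def add_divide_distrib)
  also have "of_nat N * meval x (psi (N - 1)) / fact N = a (N - 1)"
    using assms(2) by (cases N) (auto simp: a_def)
  also have "meval x (sigma_star N) / fact N = meval x (sigma_hat N)"
    by (simp add: sigma_hat_def)
  also have "?S / fact N = (\<Sum>\<nu>=2..N. (- 1) ^ (\<nu> + 1) * ?B \<nu>)"
    unfolding sum_divide_distrib
  proof (rule sum.cong[OF refl])
    fix \<nu> assume "\<nu> \<in> {2..N}"
    then have "?B \<nu> = (\<Sum>k=0..min \<nu> (N - \<nu>). of_int (stirling1 (\<nu> + 1) (k + 1)) *
       (meval x (bell_partial (N - k) \<nu> psi) / fact (N - k)))"
      unfolding a_def using assms by (intro coeff_shifted_binomial_poly_mult_power) auto
    then show "(\<Sum>k=0..min \<nu> (N - \<nu>). (- 1) ^ (\<nu> + 1) * of_int (stirling1 (\<nu> + 1) (k + 1)) *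
      (fact N / fact (N - k)) * meval x (bell_partial (N - k) \<nu> psi) / fact N) = (- 1) ^ (\<nu> + 1) * ?B \<nu>"
      by (simp only: sum_distrib_left) (intro sum.cong; simp)
  qed
  \<comment> \<open>The added terms vanish, and the range no longer depends on \<open>N\<close>: all
    degrees now belong to one polynomial identity.\<close>
  also have "(\<Sum>\<nu>=2..N. (- 1) ^ (\<nu> + 1) * ?B \<nu>) = (\<Sum>\<nu>=2..n. (- 1) ^ (\<nu> + 1) * ?B \<nu>)"
    using assms zero by (intro sum.mono_neutral_left) auto
  finally show ?thesis .
qed

section \<open>Passage to \<open>t = p\<close> and the successive approximations\<close>

lemma p_integral_poly:
  assumes "\<And>k. p_integral p (coeff f k)" "p_integral p x"
  shows "p_integral p (poly f x)"
  unfolding poly_altdef using assms by (intro p_integral_sum p_integral_mult p_integral_power)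

lemma p_integral_coeff_mult:
  assumes "\<And>k. p_integral p (coeff f k)" "\<And>k. p_integral p (coeff g k)"
  shows "p_integral p (coeff (f * g) k)"
  unfolding coeff_mult using assms by (intro p_integral_sum p_integral_mult)

lemma p_integral_coeff_power:
  assumes "\<And>k. p_integral p (coeff f k)"
  shows "p_integral p (coeff (f ^ m) k)"
proof (induction m arbitrary: k)
  case 0
  show ?case by (simp add: coeff_1)
next
  case (Suc m)
  then show ?case using assms by (simp add: p_integral_coeff_mult)
qed

lemma sum_atLeast1_atMost_Suc:
  "(\<Sum>i=1..Suc n. f i) = f 1 + (\<Sum>i=1..n. f (i + 1) :: 'a :: comm_monoid_add)"
  by (induction n) (auto simp: add.assoc)

text \<open>The defect \<open>P\<close> of the functional equation for the truncated series has no
  terms up to degree \<open>n\<close>. Its value at \<open>p\<close> is thus divisible by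
  \<open>p ^ (n + 1)\<close>, and one factor \<open>p\<close> is lost in passing from
  \<open>A(p)\<close> to \<open>V = A(p) / p\<close>.\<close>

lemma rat_cong_psi_series:
  fixes x :: "nat \<Rightarrow> rat" and n p :: nat
  defines "V \<equiv> \<Sum>i=1..n. of_nat p ^ (i - 1) / fact i * meval x (psi i)"
  assumes p: "prime p" and n: "n < p" and x: "\<And>i. p_integral p (x i)"
  shows "rat_cong p n (V) (of_nat p * V +
    (\<Sum>i=1..n. of_nat p ^ (i - 1) * meval x (sigma_hat i)) +
    (\<Sum>\<nu>=2..n. of_nat p ^ (\<nu> - 1) * (of_nat ((p - 1) choose \<nu>) * (- 1) ^ (\<nu> + 1) * V ^ \<nu>)))"
    (is "rat_cong p n _ ?R")
proof -
  define a where "a = (\<lambda>i. meval x (psi i) / fact i)"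
  define A where "A = (\<Sum>i=1..n. monom (a i) i)"
  define S where "S = (\<Sum>i=1..n. monom (meval x (sigma_hat i)) i)"
  define P where "P = A - monom 1 1 * A - S -
    (\<Sum>\<nu>=2..n. smult ((- 1) ^ (\<nu> + 1)) (shifted_binomial_poly \<nu> * A ^ \<nu>))"
  have p0: "p > 0" using p by (rule prime_gt_0_nat)
  have a0: "a 0 = 0" by (simp add: a_def psi_0)
  have coeff_A: "coeff A k = (if k \<le> n then a k else 0)" for k
    using a0 by (cases k) (auto simp: A_def coeff_sum)
  have coeff_S: "coeff S k = (if 1 \<le> k \<and> k \<le> n then meval x (sigma_hat k) else 0)" for k
    by (auto simp: S_def coeff_sum)
  have "coeff P k = 0" if "k \<le> n" for k
  proof (cases k)
    case 0
    have "coeff (shifted_binomial_poly \<nu> * A ^ \<nu>) 0 = 0" if "\<nu> \<in> {2..n}" for \<nu>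
      using that coeff_power_monom_sum_eq_0[of 0 \<nu> a n] by (simp add: coeff_mult A_def)
    then show ?thesis
      using 0 a0 by (simp add: P_def coeff_A coeff_S coeff_monom_mult coeff_sum)
  next
    case (Suc k')
    then have "a k = a (k - 1) + meval x (sigma_hat k) +
      (\<Sum>\<nu>=2..n. (- 1) ^ (\<nu> + 1) * coeff (shifted_binomial_poly \<nu> * A ^ \<nu>) k)"
      unfolding a_def A_def using that by (intro meval_psi_recurrence) auto
    then show ?thesis
      using Suc that by (simp add: P_def coeff_A coeff_S coeff_monom_mult coeff_sum)
  qed
  then have "monom 1 (Suc n) dvd P"
    by (simp add: monom_1_dvd_iff' less_Suc_eq_le)
  then obtain Q where Q: "P = monom 1 (Suc n) * Q" by (rule dvdE)
  have a_int: "p_integral p (a i)" if "i \<le> n" for i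
    unfolding a_def using p n that x by (intro p_integral_divide_fact p_integral_psi) auto
  have s_int: "p_integral p (meval x (sigma_hat i))" if "i \<le> n" for i
    using p n that x by (intro p_integral_sigma_hat) auto
  have b_int: "p_integral p (coeff (shifted_binomial_poly \<nu>) k)" if "\<nu> \<le> n" for \<nu> k
    using p n that by (auto simp: coeff_shifted_binomial_poly intro!: p_integral_divide_fact)
  have A_int: "p_integral p (coeff A k)" for k
    using a_int by (simp add: coeff_A)
  have X_int: "p_integral p (coeff (monom 1 1) k)" for k
    by simp
  have "p_integral p (coeff P k)" for k
    unfolding P_def coeff_diff coeff_sum coeff_smult
    using A_int b_int X_int s_int p_integral_of_int[of p "- 1"]
    by (intro p_integral_diff p_integral_sum p_integral_mult p_integral_power
        p_integral_coeff_mult p_integral_coeff_power) (auto simp: coeff_S)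
  \<comment> \<open>The coefficients of \<open>Q\<close> are those of \<open>P\<close> shifted by
    \<open>n + 1\<close>, so the cofactor of \<open>p ^ (n + 1)\<close> in \<open>P(p)\<close> is
    \<open>p\<close>-integral.\<close>
  then have "p_integral p (coeff Q k)" for k
    using Q coeff_monom_mult[of 1 "Suc n" Q "k + Suc n"] by (metis add_diff_cancel_right' mult_1 not_add_less2)
  then have "rat_cong p (Suc n) (poly P (of_nat p)) 0"
    unfolding Q poly_mult poly_monom mult_1_left
    by (intro rat_cong_multiple_0 p_integral_poly) auto
  moreover have pV: "poly A (of_nat p) = of_nat p * V"
    unfolding A_def V_def a_def poly_sum poly_monom sum_distrib_left
    by (intro sum.cong) (auto simp: power_eq_if)
  moreover have "poly S (of_nat p) = of_nat p * (\<Sum>i=1..n. of_nat p ^ (i - 1) * meval x (sigma_hat i))"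
    unfolding S_def poly_sum poly_monom sum_distrib_left
    by (intro sum.cong) (auto simp: power_eq_if)
  moreover have "(\<Sum>\<nu>=2..n. (- 1) ^ (\<nu> + 1) * (of_nat ((p - 1) choose \<nu>) * (of_nat p * V) ^ \<nu>)) =
      of_nat p * (\<Sum>\<nu>=2..n. of_nat p ^ (\<nu> - 1) * (of_nat ((p - 1) choose \<nu>) * (- 1) ^ (\<nu> + 1) * V ^ \<nu>))"
    unfolding sum_distrib_left
  proof (rule sum.cong[OF refl])
    fix \<nu> assume "\<nu> \<in> {2..n}"
    then have "(of_nat p :: rat) ^ \<nu> = of_nat p * of_nat p ^ (\<nu> - 1)"
      by (simp add: power_eq_if)
    then show "(- 1) ^ (\<nu> + 1) * (of_nat ((p - 1) choose \<nu>) * (of_nat p * V) ^ \<nu>) =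
      of_nat p * (of_nat p ^ (\<nu> - 1) * (of_nat ((p - 1) choose \<nu>) * (- 1) ^ (\<nu> + 1) * V ^ \<nu>))"
      by (simp add: power_mult_distrib)
  qed
  \<comment> \<open>The left side is \<open>P(p)\<close>, each of whose summands contains a factor
    \<open>p\<close>.\<close>
  ultimately have "rat_cong p (Suc n) (of_nat p * V - of_nat p * ?R) 0"
    using p0 by (simp add: P_def poly_sum poly_monom poly_shifted_binomial_poly algebra_simps)
  then have "rat_cong p (Suc n) (of_nat p * V) (of_nat p * ?R)"
    unfolding rat_cong_def by simp
  then show ?thesis by (rule rat_cong_cancel[OF p0])
qed

text \<open>Here the \<open>x i\<close> are arbitrary \<open>p\<close>-integral values; the theorem
  takes \<open>x i = Q_p(i)\<close>. The full sum \<open>V\<close> up to \<open>n\<close> serves as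
  a common target for all \<open>l\<close> and is truncated to \<open>l\<close> only at the
  end.\<close>

lemma rat_cong_psi_series_of_recurrence:
  fixes x w :: "nat \<Rightarrow> rat"
  assumes p: "prime p" and n: "n < p" and x: "\<And>i. p_integral p (x i)"
    and w_int: "\<And>l. l \<in> {1..n} \<Longrightarrow> p_integral p (w l)"
    and w1: "rat_cong p 1 (w 1) (x 1)"
    and w: "\<And>l. l \<in> {2..n} \<Longrightarrow> rat_cong p l (w l) (x 1 + of_nat p * w (l - 1) +
      (\<Sum>\<nu>=1..l - 1. of_nat p ^ \<nu> * (meval x (sigma_hat (\<nu> + 1)) +
         of_nat ((p - 1) choose (\<nu> + 1)) * (- 1) ^ \<nu> * w (l - \<nu>) ^ (\<nu> + 1))))"
    and l: "l \<in> {1..n}"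
  shows "rat_cong p l (w l) (\<Sum>\<nu>=1..l. of_nat p ^ (\<nu> - 1) / fact \<nu> * meval x (psi \<nu>))"
proof -
  define V where "V = (\<Sum>\<nu>=1..n. of_nat p ^ (\<nu> - 1) / fact \<nu> * meval x (psi \<nu>))"
  define t where "t = (\<lambda>\<nu> v. meval x (sigma_hat (\<nu> + 1)) +
         of_nat ((p - 1) choose (\<nu> + 1)) * (- 1) ^ \<nu> * v ^ (\<nu> + 1))"
  obtain n' where n': "n = Suc n'" using l by (cases n) auto
  have m1_int: "p_integral p (- 1)"
    using p_integral_of_int[of p "- 1"] by simp
  have psi_int: "p_integral p (meval x (psi i) / fact i)" if "i \<le> n" for i
    using p n that x by (intro p_integral_divide_fact p_integral_psi) auto
  have s_int: "p_integral p (meval x (sigma_hat i))" if "i \<le> n" for i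
    using p n that x by (intro p_integral_sigma_hat) auto
  \<comment> \<open>Separating the first term gives the rest the shape required by
    \<open>rat_cong_sum_truncate\<close>.\<close>
  have V_sum: "(\<Sum>\<nu>=1..m. of_nat p ^ (\<nu> - 1) / fact \<nu> * meval x (psi \<nu>)) =
      meval x (psi 1) + (\<Sum>\<nu>=1..m - 1. of_nat p ^ \<nu> * (meval x (psi (\<nu> + 1)) / fact (\<nu> + 1)))"
    if "m \<ge> 1" for m
    using that sum_atLeast1_atMost_Suc[of "\<lambda>\<nu>. of_nat p ^ (\<nu> - 1) / fact \<nu> * meval x (psi \<nu>)" "m - 1"]
    by (simp del: fact_Suc sum.cl_ivl_Suc)
  have V_int: "p_integral p V"
    unfolding V_def using p_integral_mult[OF p_integral_power[OF p_integral_of_nat] psi_int]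
    by (intro p_integral_sum) auto
  have V_cong: "rat_cong p n V (x 1 + of_nat p * V + (\<Sum>\<nu>=1..n - 1. of_nat p ^ \<nu> * t \<nu> V))"
  proof -
    \<comment> \<open>Both sums are reindexed by one to match the recurrence for \<open>w\<close>;
      the separate term \<open>x 1\<close> is the value of \<open>sigma_hat 1\<close>.\<close>
    have "(\<Sum>i=1..n. of_nat p ^ (i - 1) * meval x (sigma_hat i)) =
        x 1 + (\<Sum>\<nu>=1..n - 1. of_nat p ^ \<nu> * meval x (sigma_hat (\<nu> + 1)))"
      unfolding n' sum_atLeast1_atMost_Suc using sigma_star_1 by (simp add: sigma_hat_def)
    moreover have "(\<Sum>\<nu>=2..n. of_nat p ^ (\<nu> - 1) * (of_nat ((p - 1) choose \<nu>) * (- 1) ^ (\<nu> + 1) * V ^ \<nu>)) =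
        (\<Sum>\<nu>=1..n - 1. of_nat p ^ \<nu> * (of_nat ((p - 1) choose (\<nu> + 1)) * (- 1) ^ \<nu> * V ^ (\<nu> + 1)))"
      by (simp add: n' numeral_2_eq_2 sum.shift_bounds_cl_Suc_ivl del: sum.cl_ivl_Suc binomial_Suc_Suc)
    ultimately show ?thesis
      using rat_cong_psi_series[OF p n, of x, folded V_def] x
      by (simp only: t_def distrib_left sum.distrib add_ac)
  qed
  have t_cong: "rat_cong p m (t \<nu> u) (t \<nu> v)"
    if "rat_cong p m u v" "p_integral p u" "p_integral p v" for m \<nu> u v
    unfolding t_def using that m1_int
    by (intro rat_cong_add rat_cong_mult rat_cong_refl rat_cong_power p_integral_mult p_integral_power
        p_integral_of_nat)
  have t_int: "p_integral p (t \<nu> V)" if "\<nu> \<in> {1..n - 1}" for \<nu>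
    unfolding t_def using that V_int m1_int s_int
    by (intro p_integral_add p_integral_mult p_integral_power p_integral_of_nat) auto
  have V_trunc: "rat_cong p m V (x 1 + of_nat p * V + (\<Sum>\<nu>=1..m - 1. of_nat p ^ \<nu> * t \<nu> V))"
    if "1 \<le> m" "m \<le> n" for m
  proof -
    have "rat_cong p (Suc (m - 1)) (\<Sum>\<nu>=1..n - 1. of_nat p ^ \<nu> * t \<nu> V)
        (\<Sum>\<nu>=1..m - 1. of_nat p ^ \<nu> * t \<nu> V)"
      using that t_int by (intro rat_cong_sum_truncate) auto
    then show ?thesis
      using that by (intro rat_cong_trans[OF rat_cong_mono[OF V_cong]] rat_cong_add rat_cong_refl) auto
  qed
  have "rat_cong p l (w l) V"
    using l
  proof (induction l rule: less_induct)
    case (less l)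
    show ?case
    proof (cases "l = 1")
      case True
      have "rat_cong p 1 (x 1 + of_nat p * V) (x 1 + 0)"
        using rat_cong_multiple_0[OF V_int, of 1 1] by (intro rat_cong_add) auto
      then have "rat_cong p 1 V (x 1)"
        using V_trunc[of 1] less.prems by (auto intro: rat_cong_trans)
      then show ?thesis
        using True w1 by (auto intro: rat_cong_trans rat_cong_sym)
    next
      case False
      then have l: "2 \<le> l" "l \<le> n" using less.prems by auto
      have "rat_cong p (1 + (l - 1)) (of_nat p ^ 1 * w (l - 1)) (of_nat p ^ 1 * V)"
        using l by (intro rat_cong_scale less.IH) auto
      \<comment> \<open>The induction hypothesis holds modulo \<open>p ^ (l - \<nu>)\<close>, and
        the factor \<open>p ^ \<nu>\<close> restores the modulus \<open>p ^ l\<close>.\<close>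
      moreover have "rat_cong p l (of_nat p ^ \<nu> * t \<nu> (w (l - \<nu>))) (of_nat p ^ \<nu> * t \<nu> V)"
        if "\<nu> \<in> {1..l - 1}" for \<nu>
      proof -
        have "rat_cong p (\<nu> + (l - \<nu>)) (of_nat p ^ \<nu> * t \<nu> (w (l - \<nu>))) (of_nat p ^ \<nu> * t \<nu> V)"
          using l that by (intro rat_cong_scale t_cong less.IH w_int V_int) auto
        moreover have "\<nu> + (l - \<nu>) = l" using that l by auto
        ultimately show ?thesis by simp
      qed
      ultimately have "rat_cong p l
          (x 1 + of_nat p * w (l - 1) + (\<Sum>\<nu>=1..l - 1. of_nat p ^ \<nu> * t \<nu> (w (l - \<nu>))))
          (x 1 + of_nat p * V + (\<Sum>\<nu>=1..l - 1. of_nat p ^ \<nu> * t \<nu> V))"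
        using l by (intro rat_cong_add rat_cong_sum rat_cong_refl) auto
      then have "rat_cong p l (w l) (x 1 + of_nat p * V + (\<Sum>\<nu>=1..l - 1. of_nat p ^ \<nu> * t \<nu> V))"
        using w[of l] l unfolding t_def by (auto intro: rat_cong_trans)
      then show ?thesis
        using V_trunc[of l] l by (auto intro: rat_cong_trans rat_cong_sym)
    qed
  qed
  also have "rat_cong p (Suc (l - 1)) V (\<Sum>\<nu>=1..l. of_nat p ^ (\<nu> - 1) / fact \<nu> * meval x (psi \<nu>))"
  proof -
    have "rat_cong p (Suc (l - 1))
        (\<Sum>\<nu>=1..n - 1. of_nat p ^ \<nu> * (meval x (psi (\<nu> + 1)) / fact (\<nu> + 1)))
        (\<Sum>\<nu>=1..l - 1. of_nat p ^ \<nu> * (meval x (psi (\<nu> + 1)) / fact (\<nu> + 1)))"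
      using l by (intro rat_cong_sum_truncate psi_int) auto
    then show ?thesis
      unfolding V_def using l by (subst (1 2) V_sum) (auto intro: rat_cong_add rat_cong_refl)
  qed
  then have "rat_cong p l V (\<Sum>\<nu>=1..l. of_nat p ^ (\<nu> - 1) / fact \<nu> * meval x (psi \<nu>))"
    using l by simp
  finally show ?thesis .
qed

theorem theorem3p4:
  shows "(\<forall>\<nu>. const_term (psi \<nu>) = 0) \<and> psi 1 = mvar 1 \<and>
    (\<forall>(n::nat) (p::nat) (w :: nat \<Rightarrow> rat).
       n \<ge> 2 \<longrightarrow> prime p \<longrightarrow> odd p \<longrightarrow> p > n \<longrightarrow>
       (\<forall>l\<in>{1..n}. p_integral p (w l)) \<longrightarrow>
       rat_cong p 1 (w 1) (fermat_quot_sum p 1) \<longrightarrow>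
       (\<forall>l\<in>{2..n}. rat_cong p l (w l)
          (fermat_quot_sum p 1 + of_nat p * w (l - 1) +
           (\<Sum>\<nu>=1..l - 1. of_nat p ^ \<nu> *
              (meval (fermat_quot_sum p) (sigma_hat (\<nu> + 1)) +
               of_nat ((p - 1) choose (\<nu> + 1)) * (- 1) ^ \<nu> * w (l - \<nu>) ^ (\<nu> + 1))))) \<longrightarrow>
       (\<forall>l\<in>{1..n}. rat_cong p l (w l)
          (\<Sum>\<nu>=1..l. of_nat p ^ (\<nu> - 1) / fact \<nu> * meval (fermat_quot_sum p) (psi \<nu>))))"
proof (intro conjI allI impI ballI)
  show "const_term (psi \<nu>) = 0" for \<nu>
    by (rule const_term_psi)
  show "psi 1 = mvar 1"
    by (rule psi_1)
next
  fix n p l :: nat and w :: "nat \<Rightarrow> rat"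
  assume "prime p" "n < p" "\<forall>l\<in>{1..n}. p_integral p (w l)"
    "rat_cong p 1 (w 1) (fermat_quot_sum p 1)"
    "\<forall>l\<in>{2..n}. rat_cong p l (w l)
          (fermat_quot_sum p 1 + of_nat p * w (l - 1) +
           (\<Sum>\<nu>=1..l - 1. of_nat p ^ \<nu> *
              (meval (fermat_quot_sum p) (sigma_hat (\<nu> + 1)) +
               of_nat ((p - 1) choose (\<nu> + 1)) * (- 1) ^ \<nu> * w (l - \<nu>) ^ (\<nu> + 1))))"
    "l \<in> {1..n}"
  then show "rat_cong p l (w l)
      (\<Sum>\<nu>=1..l. of_nat p ^ (\<nu> - 1) / fact \<nu> * meval (fermat_quot_sum p) (psi \<nu>))"
    by (intro rat_cong_psi_series_of_recurrence p_integral_fermat_quot_sum) blast+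
qed

end
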